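(* Let $\ell:\mathcal{H}\times\mathcal{Z}\to[0,M]$ be $L$-Lipschitz in $h$, and let the objective $F$ be $\sigma$-strongly convex, $L$-Lipschitz and $\nu$-smooth. Suppose SGD is run for $T$ iterations from a fixed initial hypothesis with the uniform sampling distribution $P$ on $\{1,\dots,n\}^T$ and step sizes $\alpha_t=(\sigma t+\nu)^{-1}$. Then SGD is $(\beta,\rho)$-uniformly stable with respect to $\ell$ and $P$, with $$\beta\le\frac{2L^2}{\sigma n}\quad\text{and}\quad\rho\le\frac{2L^2}{\sigma T}.$$
   Context: Setting: $\mathcal{Z}=\mathcal{X}\times\mathcal{Y}$ with $\mathcal{X}$ compact, $\mathcal{H}$ a subset of Euclidean space, dataset $S=(z_1,\dots,z_n)\in\mathcal{Z}^n$. SGD with hyperparameters $\theta=(i_1,\dots,i_T)\in\Theta=\{1,\dots,n\}^T$ performs $h_t=h_{t-1}-\alpha_t\nabla F(h_{t-1},z_{i_t})$, $t=1,\dots,T$, and outputs $A(S,\theta)=h_T$. $f$ is $L$-Lipschitz if $|f(h,z)-f(h',z)|\le L\|h-h'\|$; $\nu$-smooth if $\|\nabla f(h,z)-\nabla f(h',z)\|\le\nu\|h-h'\|$; $\sigma$-strongly convex if $\frac{\sigma}{2}\|h'-h\|^2+\langle\nabla f(h,z),h'-h\rangle\le f(h',z)-f(h,z)$, all for every $h,h'\in\mathcal{H}$, $z\in\mathcal{Z}$. $\beta$-uniform (data) stability w.r.t. $\ell$ and $P$: $\sup_{S,S':d_H(S,S')=1}\sup_{z}\big|\mathbb{E}_{\theta\sim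 P}[\ell(A(S,\theta),z)-\ell(A(S',\theta),z)]\big|\le\beta$ ($d_H$ = Hamming distance). $\rho$-uniform hyperparameter stability w.r.t. $\ell$: $\sup_{S}\sup_z\sup_{\theta,\theta'\in\Theta:d_H(\theta,\theta')=1}|\ell(A(S,\theta),z)-\ell(A(S,\theta'),z)|\le\rho$. $(\beta,\rho)$-uniformly stable means both hold. *)

theory Defs
  imports "HOL-Analysis.Analysis" "HOL-Probability.Probability"
begin

text \<open>Datasets S = (z_1,...,z_n) are lists of length n; hyperparameters
  theta = (i_1,...,i_T) are lists of length T with entries in {1..n}.
  z_i is the list entry S ! (i - 1).\<close>

definition hamming :: "'b list \<Rightarrow> 'b list \<Rightarrow> nat" where
  "hamming xs ys = card {i. i < length xs \<and> xs ! i \<noteq> ys ! i}"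

definition datasets :: "'z set \<Rightarrow> nat \<Rightarrow> 'z list set" where
  "datasets Z n = {S. length S = n \<and> set S \<subseteq> Z}"

definition hyperparams :: "nat \<Rightarrow> nat \<Rightarrow> nat list set" where
  "hyperparams n T = {\<theta>. length \<theta> = T \<and> set \<theta> \<subseteq> {1..n}}"

primrec sgd_iter ::
  "(nat \<Rightarrow> real) \<Rightarrow> ('a::real_normed_vector \<Rightarrow> 'z \<Rightarrow> 'a) \<Rightarrow> 'a \<Rightarrow> 'z list \<Rightarrow> nat list \<Rightarrow> nat \<Rightarrow> 'a"
where
  "sgd_iter \<alpha> g h0 S \<theta> 0 = h0"
| "sgd_iter \<alpha> g h0 S \<theta> (Suc t) =
     sgd_iter \<alpha> g h0 S \<theta> t - \<alpha> (Suc t) *\<^sub>R g (sgd_iter \<alpha> g h0 S \<theta> t) (S ! (\<theta> ! t - 1))"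

definition sgd :: "(nat \<Rightarrow> real) \<Rightarrow> ('a::real_normed_vector \<Rightarrow> 'z \<Rightarrow> 'a) \<Rightarrow> 'a \<Rightarrow> 'z list \<Rightarrow> nat list \<Rightarrow> 'a"
  where "sgd \<alpha> g h0 S \<theta> = sgd_iter \<alpha> g h0 S \<theta> (length \<theta>)"

definition lipschitz_in_h :: "'a::real_normed_vector set \<Rightarrow> 'z set \<Rightarrow> ('a \<Rightarrow> 'z \<Rightarrow> real) \<Rightarrow> real \<Rightarrow> bool" where
  "lipschitz_in_h H Z f L \<longleftrightarrow>
     (\<forall>h\<in>H. \<forall>h'\<in>H. \<forall>z\<in>Z. \<bar>f h z - f h' z\<bar> \<le> L * norm (h - h'))"

definition is_gradient :: "'a::real_inner set \<Rightarrow> 'z set \<Rightarrow> ('a \<Rightarrow> 'z \<Rightarrow> real) \<Rightarrow> ('a \<Rightarrow> 'z \<Rightarrow> 'a) \<Rightarrow> bool" where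
  "is_gradient H Z F g \<longleftrightarrow>
     (\<forall>h\<in>H. \<forall>z\<in>Z. ((\<lambda>x. F x z) has_derivative (\<lambda>v. g h z \<bullet> v)) (at h))"

definition smooth_in_h :: "'a::real_inner set \<Rightarrow> 'z set \<Rightarrow> ('a \<Rightarrow> 'z \<Rightarrow> 'a) \<Rightarrow> real \<Rightarrow> bool" where
  "smooth_in_h H Z g \<nu> \<longleftrightarrow>
     (\<forall>h\<in>H. \<forall>h'\<in>H. \<forall>z\<in>Z. norm (g h z - g h' z) \<le> \<nu> * norm (h - h'))"

definition strongly_convex_in_h :: "'a::real_inner set \<Rightarrow> 'z set \<Rightarrow> ('a \<Rightarrow> 'z \<Rightarrow> real) \<Rightarrow> ('a \<Rightarrow> 'z \<Rightarrow> 'a) \<Rightarrow> real \<Rightarrow> bool" where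
  "strongly_convex_in_h H Z F g \<sigma> \<longleftrightarrow>
     (\<forall>h\<in>H. \<forall>h'\<in>H. \<forall>z\<in>Z.
        \<sigma> / 2 * (norm (h' - h))\<^sup>2 + g h z \<bullet> (h' - h) \<le> F h' z - F h z)"

definition uniformly_data_stable ::
  "'z set \<Rightarrow> nat \<Rightarrow> ('z list \<Rightarrow> 'c \<Rightarrow> 'a) \<Rightarrow> ('a \<Rightarrow> 'z \<Rightarrow> real) \<Rightarrow> 'c pmf \<Rightarrow> real \<Rightarrow> bool" where
  "uniformly_data_stable Z n A l P \<beta> \<longleftrightarrow>
     (\<forall>S\<in>datasets Z n. \<forall>S'\<in>datasets Z n. hamming S S' = 1 \<longrightarrow> (\<forall>z\<in>Z.
        \<bar>measure_pmf.expectation P (\<lambda>\<theta>. l (A S \<theta>) z - l (A S' \<theta>) z)\<bar> \<le> \<beta>))"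

definition uniformly_hyper_stable ::
  "'z set \<Rightarrow> nat \<Rightarrow> 'c list set \<Rightarrow> ('z list \<Rightarrow> 'c list \<Rightarrow> 'a) \<Rightarrow> ('a \<Rightarrow> 'z \<Rightarrow> real) \<Rightarrow> real \<Rightarrow> bool" where
  "uniformly_hyper_stable Z n \<Theta> A l \<rho> \<longleftrightarrow>
     (\<forall>S\<in>datasets Z n. \<forall>z\<in>Z. \<forall>\<theta>\<in>\<Theta>. \<forall>\<theta>'\<in>\<Theta>. hamming \<theta> \<theta>' = 1 \<longrightarrow>
        \<bar>l (A S \<theta>) z - l (A S \<theta>') z\<bar> \<le> \<rho>)"

end

theory Submission
  imports Defs "HOL-Combinatorics.Transposition"
begin

text \<open>
  With step sizes \<alpha>_t = 1/(\<sigma> t + \<nu>), a gradient step of a \<sigma>-strongly convex, \<nu>-smooth function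
  contracts distances by the factor 1 - \<alpha>_t \<sigma>, and L-Lipschitz continuity bounds the gradients
  by L. As (\<sigma> t + \<nu>)(1 - \<alpha>_t \<sigma>) = \<sigma> (t - 1) + \<nu>, the weighted distance of two SGD runs
  telescopes: (\<sigma> T + \<nu>) |h_T - h'_T| is at most 2 L times the number of steps at which the runs
  sample different examples. For neighbouring hyperparameters there is at most one such step;
  for datasets differing in example k, there are at most as many as k is sampled, which is T/n
  on average by symmetry. The Lipschitz loss turns both into the stated bounds.

  The contraction rests on co-coercivity, whose proof evaluates F at points off the segment
  between the two iterates. As H is merely convex, these points are shown to lie in H as affine
  combinations with full gradient steps, within a relative neighbourhood of H; arbitrary pairs
  are reached by subdividing segments pushed into the relative interior.
\<close>

lemma le_of_le_plus_small:
  fixes a b K c :: real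
  assumes c: "c > 0" and le: "\<And>s. 0 < s \<Longrightarrow> s \<le> c \<Longrightarrow> a \<le> b + s * K"
  shows "a \<le> b"
proof (rule field_le_epsilon)
  fix \<epsilon> :: real assume \<epsilon>: "\<epsilon> > 0"
  define s where "s = min c (\<epsilon> / (\<bar>K\<bar> + 1))"
  have s: "0 < s" "s \<le> c" unfolding s_def using c \<epsilon> by auto
  have "s * K \<le> s * \<bar>K\<bar>" using s by (intro mult_left_mono) auto
  also have "\<dots> \<le> \<epsilon> / (\<bar>K\<bar> + 1) * \<bar>K\<bar>"
    unfolding s_def by (intro mult_right_mono) auto
  also have "\<dots> \<le> \<epsilon>" using \<epsilon> by (simp add: field_simps)
  finally show "a \<le> b + \<epsilon>" using le[OF s] by linarith
qed

lemma convex_segment_mem: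
  assumes "convex H" "x \<in> H" "y \<in> H" "0 \<le> s" "s \<le> 1"
  shows "x + s *\<^sub>R (y - x) \<in> H"
proof -
  have "(1 - s) *\<^sub>R x + s *\<^sub>R y \<in> H" using assms by (intro convexD) auto
  thus ?thesis by (simp add: algebra_simps)
qed

lemma convex_rel_ball_shrink:
  fixes H :: "'a::real_normed_vector set"
  assumes H: "convex H" and p: "p \<in> H" and w: "w \<in> H"
    and ball: "ball w e \<inter> affine hull H \<subseteq> H" and s: "0 < s" "s \<le> 1"
  shows "ball (p + s *\<^sub>R (w - p)) (s * e) \<inter> affine hull H \<subseteq> H"
proof
  fix v assume v: "v \<in> ball (p + s *\<^sub>R (w - p)) (s * e) \<inter> affine hull H"
  define q where "q = p + s *\<^sub>R (w - p)"
  define w' where "w' = w + (1 / s) *\<^sub>R (v - q)"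
  have q: "q \<in> H" unfolding q_def using convex_segment_mem[OF H p w] s by simp
  have "w' \<in> affine hull H" unfolding w'_def
    using v q w hull_subset[of H affine] by (intro mem_affine_3_minus) auto
  moreover have "norm (v - q) < s * e" using v by (simp add: q_def dist_norm norm_minus_commute)
  hence "dist w w' < e" using s by (simp add: w'_def dist_norm divide_less_eq mult.commute)
  ultimately have w': "w' \<in> H" using ball by auto
  have "v = p + s *\<^sub>R (w' - p)" using s by (simp add: w'_def q_def algebra_simps)
  thus "v \<in> H" using convex_segment_mem[OF H p w'] s by simp
qed

lemma segment_lipschitz_of_local:
  fixes f :: "'a::real_normed_vector \<Rightarrow> 'b::real_normed_vector"
  assumes r: "r > 0"
    and local: "\<And>s t. 0 \<le> s \<Longrightarrow> s \<le> 1 \<Longrightarrow> 0 \<le> t \<Longrightarrow> t \<le> 1 \<Longrightarrow>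
      norm ((s - t) *\<^sub>R (y - x)) < r \<Longrightarrow>
      norm (f (x + s *\<^sub>R (y - x)) - f (x + t *\<^sub>R (y - x))) \<le> c * norm ((s - t) *\<^sub>R (y - x))"
  shows "norm (f y - f x) \<le> c * norm (y - x)"
proof -
  obtain N :: nat where N: "norm (y - x) / r < real N" using reals_Archimedean2 by blast
  hence N0: "N > 0" using r by (metis divide_nonneg_pos norm_ge_zero of_nat_0_less_iff order.strict_trans1)
  define p where "p k = x + (real k / real N) *\<^sub>R (y - x)" for k
  have "norm (f (p k) - f x) \<le> c * (real k / real N) * norm (y - x)" if "k \<le> N" for k
    using that
  proof (induction k)
    case (Suc k)
    have "norm ((real (Suc k) / real N - real k / real N) *\<^sub>R (y - x)) = norm (y - x) / real N"
      by (simp add: diff_divide_distrib[symmetric])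
    also have "\<dots> < r" using N N0 r by (simp add: divide_less_eq mult.commute)
    finally have "norm (f (p (Suc k)) - f (p k)) \<le> c * (norm (y - x) / real N)"
      using local[of "real (Suc k) / real N" "real k / real N"] Suc.prems
      unfolding p_def by (simp add: diff_divide_distrib[symmetric])
    moreover have "norm (f (p (Suc k)) - f x) \<le> norm (f (p (Suc k)) - f (p k)) + norm (f (p k) - f x)"
      by (rule norm_diff_triangle_le[OF order_refl order_refl])
    ultimately have "norm (f (p (Suc k)) - f x)
        \<le> c * (norm (y - x) / real N) + c * (real k / real N) * norm (y - x)"
      using Suc by simp
    also have "\<dots> = c * (real (Suc k) / real N) * norm (y - x)" by (simp add: field_simps add_divide_distrib)
    finally show ?case .
  qed (simp add: p_def)
  from this[of N] show ?thesis using N0 by (simp add: p_def)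
qed

section \<open>Gradient steps of strongly convex smooth functions\<close>

lemma cocoercive_step_contraction:
  fixes d G :: "'a::real_inner"
  assumes \<sigma>: "\<sigma> > 0" and \<nu>: "\<nu> > 0" and a: "0 < a" "a \<le> 1 / (\<sigma> + \<nu>)"
    and coco: "(norm (G - \<sigma> *\<^sub>R d))\<^sup>2 \<le> \<nu> * inner (G - \<sigma> *\<^sub>R d) d"
  shows "norm (d - a *\<^sub>R G) \<le> (1 - a * \<sigma>) * norm d"
proof -
  define A where "A = inner (G - \<sigma> *\<^sub>R d) d"
  define B where "B = (norm (G - \<sigma> *\<^sub>R d))\<^sup>2"
  have "0 \<le> \<nu> * A" using coco unfolding A_def by (smt (verit) zero_le_power2)
  hence A: "A \<ge> 0" using \<nu> by (simp add: zero_le_mult_iff)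
  have "a * \<sigma> + a * \<nu> \<le> 1" using a \<sigma> \<nu> by (simp add: field_simps)
  moreover have "a * \<sigma> > 0" "a * \<nu> > 0" using a \<sigma> \<nu> by simp_all
  ultimately have c: "1 - a * \<sigma> \<ge> 0" and a\<nu>: "a * \<nu> \<le> 2 * (1 - a * \<sigma>)"
    by (simp_all add: algebra_simps)
  have "a * (a * \<nu> * A) \<le> a * (2 * (1 - a * \<sigma>) * A)"
    using mult_right_mono[OF a\<nu> A] a by (intro mult_left_mono) auto
  hence a\<nu>A: "a\<^sup>2 * (\<nu> * A) \<le> 2 * a * (1 - a * \<sigma>) * A" by (simp add: power2_eq_square mult_ac)
  have "d - a *\<^sub>R G = (1 - a * \<sigma>) *\<^sub>R d - a *\<^sub>R (G - \<sigma> *\<^sub>R d)" by (simp add: algebra_simps)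
  hence "(norm (d - a *\<^sub>R G))\<^sup>2 = (1 - a * \<sigma>)\<^sup>2 * (norm d)\<^sup>2 - 2 * a * (1 - a * \<sigma>) * A + a\<^sup>2 * B"
    unfolding A_def B_def power2_norm_eq_inner
    by (simp add: inner_simps inner_commute algebra_simps power2_eq_square)
  also have "a\<^sup>2 * B \<le> a\<^sup>2 * (\<nu> * A)"
    using coco unfolding A_def B_def by (intro mult_left_mono) auto
  also note a\<nu>A
  finally have "(norm (d - a *\<^sub>R G))\<^sup>2 \<le> ((1 - a * \<sigma>) * norm d)\<^sup>2"
    by (simp add: power_mult_distrib)
  thus ?thesis by (rule power2_le_imp_le) (use c in simp)
qed

locale strongly_convex_smooth =
  fixes H :: "'a::euclidean_space set" and Z :: "'z set"
    and F :: "'a \<Rightarrow> 'z \<Rightarrow> real" and g :: "'a \<Rightarrow> 'z \<Rightarrow> 'a"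
    and \<sigma> \<nu> L :: real
  assumes convex: "convex H" and sigma_pos: "\<sigma> > 0" and sigma_le_nu: "\<sigma> \<le> \<nu>"
    and gradient: "is_gradient H Z F g"
    and strongly_convex: "strongly_convex_in_h H Z F g \<sigma>"
    and lipschitz: "lipschitz_in_h H Z F L" and L_nonneg: "L \<ge> 0"
    and smooth: "smooth_in_h H Z g \<nu>"
    and full_step_mem: "\<forall>h\<in>H. \<forall>z\<in>Z. h - (1 / (\<sigma> + \<nu>)) *\<^sub>R g h z \<in> H"
begin

lemma nu_pos: "\<nu> > 0"
  using sigma_pos sigma_le_nu by linarith

lemma gradient_lipschitz: "x \<in> H \<Longrightarrow> y \<in> H \<Longrightarrow> z \<in> Z \<Longrightarrow> norm (g x z - g y z) \<le> \<nu> * norm (x - y)"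
  using smooth unfolding smooth_in_h_def by blast

lemma strongly_convex_ineq:
  "x \<in> H \<Longrightarrow> y \<in> H \<Longrightarrow> z \<in> Z \<Longrightarrow> \<sigma> / 2 * (norm (y - x))\<^sup>2 + inner (g x z) (y - x) \<le> F y z - F x z"
  using strongly_convex unfolding strongly_convex_in_h_def by blast

lemma smooth_upper_bound:
  assumes x: "x \<in> H" and y: "y \<in> H" and z: "z \<in> Z"
  shows "F y z \<le> F x z + inner (g x z) (y - x) + \<nu> / 2 * (norm (y - x))\<^sup>2"
proof -
  define d where "d = y - x"
  define \<phi> where "\<phi> s = F (x + s *\<^sub>R d) z - s * inner (g x z) d - \<nu> / 2 * s\<^sup>2 * (norm d)\<^sup>2" for s
  have "\<phi> 1 \<le> \<phi> 0"
  proof (rule DERIV_nonpos_imp_nonincreasing[of 0 1 \<phi>])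
    fix s :: real assume s: "0 \<le> s" "s \<le> 1"
    define p where "p = x + s *\<^sub>R d"
    have p: "p \<in> H" using convex_segment_mem[OF convex x y s] unfolding p_def d_def .
    have "((\<lambda>v. F v z) has_derivative (\<lambda>v. inner (g p z) v)) (at p)"
      using gradient p z unfolding is_gradient_def by blast
    moreover have "((\<lambda>t. x + t *\<^sub>R d) has_derivative (\<lambda>t. t *\<^sub>R d)) (at s)"
      by (auto intro!: derivative_eq_intros)
    ultimately have "((\<lambda>t. F (x + t *\<^sub>R d) z) has_derivative (\<lambda>t. inner (g p z) (t *\<^sub>R d))) (at s)"
      unfolding p_def by (rule has_derivative_compose[of "\<lambda>t. x + t *\<^sub>R d", rotated])
    moreover have "(\<lambda>t. inner (g p z) (t *\<^sub>R d)) = (*) (inner (g p z) d)" by (auto simp: mult.commute)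
    ultimately have dF: "((\<lambda>t. F (x + t *\<^sub>R d) z) has_real_derivative inner (g p z) d) (at s)"
      by (simp add: has_field_derivative_def)
    have "(\<phi> has_real_derivative inner (g p z) d - inner (g x z) d - \<nu> / 2 * (2 * s) * (norm d)\<^sup>2) (at s)"
      unfolding \<phi>_def by (rule derivative_eq_intros dF refl | simp)+
    moreover have "inner (g p z) d - inner (g x z) d \<le> \<nu> * s * (norm d)\<^sup>2"
    proof -
      have "inner (g p z) d - inner (g x z) d \<le> norm (g p z - g x z) * norm d"
        by (metis inner_diff_left norm_cauchy_schwarz)
      also have "\<dots> \<le> \<nu> * norm (p - x) * norm d"
        using gradient_lipschitz[OF p x z] by (intro mult_right_mono) auto
      finally show ?thesis using s by (simp add: p_def power2_eq_square mult_ac)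
    qed
    ultimately show "\<exists>y. (\<phi> has_real_derivative y) (at s) \<and> y \<le> 0" by auto
  qed simp
  thus ?thesis unfolding \<phi>_def d_def by simp
qed

lemma auxiliary_points_mem:
  assumes z: "z \<in> Z" and x: "x \<in> H" and y: "y \<in> H"
    and r: "ball y r \<inter> affine hull H \<subseteq> H" and close: "norm (x - y) < r / 3"
  defines "W \<equiv> (g y z - g x z) - \<sigma> *\<^sub>R (y - x)"
  shows "y - (1 / \<nu>) *\<^sub>R W \<in> H" and "x + (1 / \<nu>) *\<^sub>R W \<in> H"
proof -
  define d where "d = y - x"
  define c where "c = (\<sigma> + \<nu>) / \<nu>"
  define xp where "xp = x - (1 / (\<sigma> + \<nu>)) *\<^sub>R g x z"
  define yp where "yp = y - (1 / (\<sigma> + \<nu>)) *\<^sub>R g y z"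
  have \<nu>: "\<nu> > 0" by (rule nu_pos)
  have "norm W \<le> norm (g y z - g x z) + norm (\<sigma> *\<^sub>R d)"
    unfolding W_def d_def by (rule norm_triangle_ineq4)
  also have "\<dots> \<le> \<nu> * norm d + \<nu> * norm d"
    using gradient_lipschitz[OF y x z] sigma_pos sigma_le_nu
    by (intro add_mono) (auto simp: d_def intro: mult_right_mono)
  finally have W: "norm ((1 / \<nu>) *\<^sub>R W) \<le> 2 * norm d" using \<nu> by (simp add: field_simps)
  have d: "norm d < r / 3" using close by (simp add: d_def norm_minus_commute)
  have u: "norm ((1 / \<nu>) *\<^sub>R W) < r" "norm (d - (1 / \<nu>) *\<^sub>R W) < r"
    using W d norm_ge_zero[of d] norm_triangle_ineq4[of d "(1 / \<nu>) *\<^sub>R W"] by - linarith+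
  \<comment> \<open>Both points are affine combinations of x, y and the full gradient steps from them, which lie in H.\<close>
  have "y - (1 / \<nu>) *\<^sub>R W = x + c *\<^sub>R (yp - xp)" "x + (1 / \<nu>) *\<^sub>R W = y + c *\<^sub>R (xp - yp)"
  proof -
    have "c = 1 + \<sigma> / \<nu>" "(1 + \<sigma> / \<nu>) / (\<nu> + \<sigma>) = 1 / \<nu>"
      using \<nu> sigma_pos by (simp_all add: c_def field_simps) (smt (verit) mult_pos_pos)
    thus "y - (1 / \<nu>) *\<^sub>R W = x + c *\<^sub>R (yp - xp)" "x + (1 / \<nu>) *\<^sub>R W = y + c *\<^sub>R (xp - yp)"
      unfolding W_def xp_def yp_def by (simp_all add: algebra_simps scaleR_add_left)
  qed
  moreover have "xp \<in> H" "yp \<in> H" using full_step_mem x y z by (auto simp: xp_def yp_def)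
  ultimately have "y - (1 / \<nu>) *\<^sub>R W \<in> affine hull H" "x + (1 / \<nu>) *\<^sub>R W \<in> affine hull H"
    using x y hull_subset[of H affine] by (auto intro!: mem_affine_3_minus)
  moreover have "y - (1 / \<nu>) *\<^sub>R W \<in> ball y r" "x + (1 / \<nu>) *\<^sub>R W \<in> ball y r"
    using u by (simp_all add: dist_norm d_def algebra_simps)
  ultimately show "y - (1 / \<nu>) *\<^sub>R W \<in> H" "x + (1 / \<nu>) *\<^sub>R W \<in> H" using r by blast+
qed

lemma cocoercive_near:
  assumes z: "z \<in> Z" and x: "x \<in> H" and y: "y \<in> H"
    and r: "ball y r \<inter> affine hull H \<subseteq> H" and close: "norm (x - y) < r / 3"
  defines "W \<equiv> (g y z - g x z) - \<sigma> *\<^sub>R (y - x)"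
  shows "(norm W)\<^sup>2 \<le> \<nu> * inner W (y - x)"
proof -
  define d where "d = y - x"
  define u where "u = (1 / \<nu>) *\<^sub>R W"
  have \<nu>: "\<nu> > 0" by (rule nu_pos)
  have G: "g y z - g x z = \<nu> *\<^sub>R u + \<sigma> *\<^sub>R d" using \<nu> by (simp add: u_def W_def d_def)
  have z1: "y - u \<in> H" and z2: "x + u \<in> H"
    using auxiliary_points_mem[OF z x y r close] unfolding u_def W_def by simp_all
  \<comment> \<open>The usual co-coercivity argument, for the gradient of F - \<sigma>/2 |.|^2: y - u and x + u are
    steps of length 1/\<nu> along the difference W of its gradients; add strong convexity and
    smoothness at the pairs (x, y - u) and (y, x + u).\<close>
  have "\<sigma> * (norm (d - u))\<^sup>2 - inner (g y z - g x z) (d - u) + inner (g y z - g x z) u - \<nu> * (norm u)\<^sup>2 \<le> 0"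
  proof -
    have e: "(y - u) - x = d - u" "(y - u) - y = - u" "(x + u) - y = - (d - u)" "(x + u) - x = u"
      by (simp_all add: d_def algebra_simps)
    show ?thesis
      using strongly_convex_ineq[OF x z1 z] smooth_upper_bound[OF y z1 z]
        strongly_convex_ineq[OF y z2 z] smooth_upper_bound[OF x z2 z]
      unfolding e norm_minus_cancel inner_minus_right inner_diff_left by linarith
  qed
  also have "\<sigma> * (norm (d - u))\<^sup>2 - inner (g y z - g x z) (d - u) + inner (g y z - g x z) u - \<nu> * (norm u)\<^sup>2
      = \<sigma> * inner u u + \<nu> * (inner u u - inner u d)"
    unfolding G power2_norm_eq_inner by (simp add: inner_simps inner_commute algebra_simps)
  finally have "\<nu> * (inner u u - inner u d) \<le> 0" using sigma_pos by (smt (verit) inner_ge_zero mult_nonneg_nonneg)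
  hence "inner u u \<le> inner u d" using \<nu> by (simp add: mult_le_0_iff)
  hence "\<nu>\<^sup>2 * inner u u \<le> \<nu>\<^sup>2 * inner u d" by (simp add: mult_left_mono)
  hence "inner W W \<le> \<nu> * inner W (y - x)" using \<nu> by (simp add: u_def d_def power2_eq_square)
  thus ?thesis unfolding power2_norm_eq_inner .
qed

lemma step_factor_nonneg: "0 < a \<Longrightarrow> a \<le> 1 / (\<sigma> + \<nu>) \<Longrightarrow> 0 \<le> 1 - a * \<sigma>"
  using sigma_pos nu_pos by (simp add: field_simps) (smt (verit) mult_pos_pos)

lemma gradient_step_contraction_near:
  assumes z: "z \<in> Z" and x: "x \<in> H" and y: "y \<in> H"
    and r: "ball y r \<inter> affine hull H \<subseteq> H" and close: "norm (x - y) < r / 3"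
    and a: "0 < a" "a \<le> 1 / (\<sigma> + \<nu>)"
  shows "norm ((x - a *\<^sub>R g x z) - (y - a *\<^sub>R g y z)) \<le> (1 - a * \<sigma>) * norm (x - y)"
proof -
  have "norm ((y - x) - a *\<^sub>R (g y z - g x z)) \<le> (1 - a * \<sigma>) * norm (y - x)"
    using cocoercive_near[OF z x y r close] by (rule cocoercive_step_contraction[OF sigma_pos nu_pos a])
  moreover have "(x - a *\<^sub>R g x z) - (y - a *\<^sub>R g y z) = - ((y - x) - a *\<^sub>R (g y z - g x z))"
    by (simp add: algebra_simps)
  ultimately show ?thesis by (simp only: norm_minus_cancel norm_minus_commute[of y])
qed

lemma gradient_step_lipschitz:
  assumes z: "z \<in> Z" and x: "x \<in> H" and y: "y \<in> H" and a: "0 \<le> a"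
  shows "norm ((x - a *\<^sub>R g x z) - (y - a *\<^sub>R g y z)) \<le> (1 + a * \<nu>) * norm (x - y)"
proof -
  have "(x - a *\<^sub>R g x z) - (y - a *\<^sub>R g y z) = (x - y) - a *\<^sub>R (g x z - g y z)"
    by (simp add: algebra_simps)
  also have "norm \<dots> \<le> norm (x - y) + norm (a *\<^sub>R (g x z - g y z))"
    by (rule norm_triangle_ineq4)
  also have "norm (a *\<^sub>R (g x z - g y z)) \<le> a * (\<nu> * norm (x - y))"
    using gradient_lipschitz[OF x y z] a by (simp add: mult_left_mono)
  finally show ?thesis by (simp add: algebra_simps)
qed

lemma gradient_step_contraction_segment:
  assumes z: "z \<in> Z" and x: "x \<in> H" and y: "y \<in> H" and r: "r > 0"
    and balls: "\<And>t. 0 \<le> t \<Longrightarrow> t \<le> 1 \<Longrightarrow> ball (x + t *\<^sub>R (y - x)) r \<inter> affine hull H \<subseteq> H"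
    and a: "0 < a" "a \<le> 1 / (\<sigma> + \<nu>)"
  shows "norm ((x - a *\<^sub>R g x z) - (y - a *\<^sub>R g y z)) \<le> (1 - a * \<sigma>) * norm (x - y)"
proof -
  define G where "G w = w - a *\<^sub>R g w z" for w
  have "norm (G y - G x) \<le> (1 - a * \<sigma>) * norm (y - x)"
  proof (rule segment_lipschitz_of_local[of "r / 3"])
    fix s t :: real assume s: "0 \<le> s" "s \<le> 1" and t: "0 \<le> t" "t \<le> 1"
      and close: "norm ((s - t) *\<^sub>R (y - x)) < r / 3"
    define p where "p = x + s *\<^sub>R (y - x)"
    define q where "q = x + t *\<^sub>R (y - x)"
    have pq: "p - q = (s - t) *\<^sub>R (y - x)" by (simp add: p_def q_def algebra_simps)
    have "p \<in> H" "q \<in> H"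
      using convex_segment_mem[OF convex x y s] convex_segment_mem[OF convex x y t] by (simp_all add: p_def q_def)
    from gradient_step_contraction_near[OF z this balls[OF t, folded q_def] _ a]
    have "norm (G p - G q) \<le> (1 - a * \<sigma>) * norm ((s - t) *\<^sub>R (y - x))"
      using close unfolding G_def pq by simp
    thus "norm (G (x + s *\<^sub>R (y - x)) - G (x + t *\<^sub>R (y - x))) \<le> (1 - a * \<sigma>) * norm ((s - t) *\<^sub>R (y - x))"
      unfolding p_def q_def .
  qed (use r in simp)
  thus ?thesis unfolding G_def by (simp add: norm_minus_commute)
qed

lemma gradient_step_contraction_shifted:
  assumes z: "z \<in> Z" and x: "x \<in> H" and y: "y \<in> H"
    and w: "w \<in> H" and e: "e > 0" and ball: "ball w e \<inter> affine hull H \<subseteq> H"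
    and s: "0 < s" "s \<le> 1" and a: "0 < a" "a \<le> 1 / (\<sigma> + \<nu>)"
  defines "xs \<equiv> x + s *\<^sub>R (w - x)" and "ys \<equiv> y + s *\<^sub>R (w - y)"
  shows "norm ((xs - a *\<^sub>R g xs z) - (ys - a *\<^sub>R g ys z)) \<le> (1 - a * \<sigma>) * norm (x - y)"
proof -
  have xs: "xs \<in> H" and ys: "ys \<in> H"
    using convex_segment_mem[OF convex x w] convex_segment_mem[OF convex y w] s
    by (simp_all add: xs_def ys_def)
  have "ball (xs + t *\<^sub>R (ys - xs)) (s * e) \<inter> affine hull H \<subseteq> H" if "0 \<le> t" "t \<le> 1" for t
  proof -
    have "xs + t *\<^sub>R (ys - xs) = (x + t *\<^sub>R (y - x)) + s *\<^sub>R (w - (x + t *\<^sub>R (y - x)))"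
      by (simp add: xs_def ys_def algebra_simps)
    thus ?thesis
      using convex_rel_ball_shrink[OF convex convex_segment_mem[OF convex x y that] w ball s] by simp
  qed
  hence "norm ((xs - a *\<^sub>R g xs z) - (ys - a *\<^sub>R g ys z)) \<le> (1 - a * \<sigma>) * norm (xs - ys)"
    using s e by (intro gradient_step_contraction_segment[OF z xs ys _ _ a, of "s * e"]) auto
  also have "\<dots> \<le> (1 - a * \<sigma>) * norm (x - y)"
  proof (rule mult_left_mono[OF _ step_factor_nonneg[OF a]])
    have "xs - ys = (1 - s) *\<^sub>R (x - y)" by (simp add: xs_def ys_def algebra_simps)
    thus "norm (xs - ys) \<le> norm (x - y)" using s by (simp add: mult_left_le_one_le)
  qed
  finally show ?thesis .
qed

lemma gradient_step_contraction:
  assumes z: "z \<in> Z" and x: "x \<in> H" and y: "y \<in> H" and a: "0 < a" "a \<le> 1 / (\<sigma> + \<nu>)"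
  shows "norm ((x - a *\<^sub>R g x z) - (y - a *\<^sub>R g y z)) \<le> (1 - a * \<sigma>) * norm (x - y)"
proof -
  define G where "G v = v - a *\<^sub>R g v z" for v
  obtain w where "w \<in> rel_interior H" using rel_interior_eq_empty[OF convex] x by blast
  then obtain e where w: "w \<in> H" and e: "e > 0" and ball: "ball w e \<inter> affine hull H \<subseteq> H"
    unfolding mem_rel_interior_ball by blast
  \<comment> \<open>Pulled towards the relative interior point w, the segment from x to y gets a uniform
    relative neighbourhood in H; the error of this shift vanishes with s.\<close>
  have "norm (G x - G y) \<le> (1 - a * \<sigma>) * norm (x - y) + s * ((1 + a * \<nu>) * (norm (x - w) + norm (w - y)))"
    if s: "0 < s" "s \<le> 1" for s
  proof -
    define xs where "xs = x + s *\<^sub>R (w - x)"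
    define ys where "ys = y + s *\<^sub>R (w - y)"
    have xs: "xs \<in> H" and ys: "ys \<in> H"
      using convex_segment_mem[OF convex x w] convex_segment_mem[OF convex y w] s
      by (simp_all add: xs_def ys_def)
    have "norm (G x - G xs) \<le> (1 + a * \<nu>) * (s * norm (x - w))"
      using gradient_step_lipschitz[OF z x xs] a s by (simp add: G_def xs_def norm_minus_commute)
    moreover have "norm (G xs - G ys) \<le> (1 - a * \<sigma>) * norm (x - y)"
      using gradient_step_contraction_shifted[OF z x y w e ball s a] by (simp add: G_def xs_def ys_def)
    moreover have "norm (G ys - G y) \<le> (1 + a * \<nu>) * (s * norm (w - y))"
      using gradient_step_lipschitz[OF z ys y] a s by (simp add: G_def ys_def)
    moreover have "norm (G x - G y) \<le> norm (G x - G xs) + norm (G xs - G ys) + norm (G ys - G y)"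
      by (rule norm_diff_triangle_le[OF norm_diff_triangle_le[OF order_refl order_refl] order_refl])
    ultimately show ?thesis by (simp add: algebra_simps)
  qed
  hence "norm (G x - G y) \<le> (1 - a * \<sigma>) * norm (x - y)" by (rule le_of_le_plus_small[OF zero_less_one])
  thus ?thesis unfolding G_def .
qed

lemma gradient_norm_le:
  assumes h: "h \<in> H" and z: "z \<in> Z"
  shows "norm (g h z) \<le> L"
proof -
  define G where "G = g h z"
  define a where "a = 1 / (\<sigma> + \<nu>)"
  have a: "a > 0" using sigma_pos nu_pos by (simp add: a_def)
  \<comment> \<open>The direction of steepest descent points into H, so the Lipschitz bound on F can be probed along it.\<close>
  have "norm G \<le> L + s * (\<nu> * norm G)" if s: "0 < s" "s \<le> a" for s
  proof -
    define h' where "h' = h - s *\<^sub>R G"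
    have "h - a *\<^sub>R G \<in> H" using full_step_mem h z by (simp add: a_def G_def)
    hence "h + (s / a) *\<^sub>R ((h - a *\<^sub>R G) - h) \<in> H"
      by (rule convex_segment_mem[OF convex h]) (use s a in simp_all)
    moreover have "h + (s / a) *\<^sub>R ((h - a *\<^sub>R G) - h) = h'" using a by (simp add: h'_def)
    ultimately have h': "h' \<in> H" by simp
    have hh': "h - h' = s *\<^sub>R G" by (simp add: h'_def)
    have "\<sigma> / 2 * (norm (h - h'))\<^sup>2 + inner (g h' z) (h - h') \<le> F h z - F h' z"
      by (rule strongly_convex_ineq[OF h' h z])
    moreover have "F h z - F h' z \<le> L * norm (h - h')"
      using lipschitz h h' z unfolding lipschitz_in_h_def by fastforce
    moreover have "0 \<le> \<sigma> / 2 * (norm (h - h'))\<^sup>2" using sigma_pos by simp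
    ultimately have "inner (g h' z) (h - h') \<le> L * norm (h - h')" by linarith
    hence "s * inner (g h' z) G \<le> s * (L * norm G)" using s unfolding hh' by (simp add: mult_ac)
    hence "inner (g h' z) G \<le> L * norm G" using s by simp
    moreover have "inner (g h' z) G \<ge> (norm G)\<^sup>2 - s * (\<nu> * norm G) * norm G"
    proof -
      have "inner (G - g h' z) G \<le> norm (G - g h' z) * norm G" by (rule norm_cauchy_schwarz)
      also have "\<dots> \<le> \<nu> * norm (h - h') * norm G"
        using gradient_lipschitz[OF h h' z] by (intro mult_right_mono) (simp_all add: G_def)
      finally show ?thesis using s by (simp add: h'_def inner_diff_left power2_norm_eq_inner mult_ac)
    qed
    ultimately have "norm G * norm G \<le> (L + s * (\<nu> * norm G)) * norm G"
      by (simp add: power2_eq_square algebra_simps)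
    thus ?thesis using L_nonneg by (cases "norm G = 0") simp_all
  qed
  thus ?thesis unfolding G_def by (rule le_of_le_plus_small[OF a])
qed

lemma gradient_steps_distance:
  assumes z: "z \<in> Z" and z': "z' \<in> Z" and h: "h \<in> H" and h': "h' \<in> H"
    and a: "0 < a" "a \<le> 1 / (\<sigma> + \<nu>)"
  shows "norm ((h - a *\<^sub>R g h z) - (h' - a *\<^sub>R g h' z'))
    \<le> (1 - a * \<sigma>) * norm (h - h') + a * (if z \<noteq> z' then 2 * L else 0)"
proof -
  have grad_diff: "norm (g h' z' - g h' z) \<le> (if z \<noteq> z' then 2 * L else 0)"
    using norm_triangle_ineq4[of "g h' z'" "g h' z"] gradient_norm_le[OF h' z] gradient_norm_le[OF h' z']
    by auto
  have "(h - a *\<^sub>R g h z) - (h' - a *\<^sub>R g h' z')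
      = ((h - a *\<^sub>R g h z) - (h' - a *\<^sub>R g h' z)) + a *\<^sub>R (g h' z' - g h' z)"
    by (simp add: algebra_simps)
  also have "norm \<dots> \<le> norm ((h - a *\<^sub>R g h z) - (h' - a *\<^sub>R g h' z)) + norm (a *\<^sub>R (g h' z' - g h' z))"
    by (rule norm_triangle_ineq)
  also have "\<dots> \<le> (1 - a * \<sigma>) * norm (h - h') + a * (if z \<noteq> z' then 2 * L else 0)"
    using gradient_step_contraction[OF z h h' a] mult_left_mono[OF grad_diff, of a] a
    by (intro add_mono) simp_all
  finally show ?thesis .
qed

end

section \<open>SGD iterates and sampling counts\<close>

lemma dataset_sample_mem:
  assumes "S \<in> datasets Z n" "\<theta> \<in> hyperparams n T" "t < T"
  shows "S ! (\<theta> ! t - 1) \<in> Z"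
proof -
  have "\<theta> ! t \<in> set \<theta>" using assms(2,3) unfolding hyperparams_def by simp
  hence "\<theta> ! t \<in> {1..n}" using assms(2) unfolding hyperparams_def by blast
  hence "\<theta> ! t - 1 < length S" using assms(1) unfolding datasets_def by auto
  thus ?thesis using assms(1) nth_mem unfolding datasets_def by blast
qed

lemma sgd_iter_mem:
  assumes h0: "h0 \<in> H" and steps: "\<forall>h\<in>H. \<forall>z\<in>Z. \<forall>t\<in>{1..T}. h - \<alpha> t *\<^sub>R g h z \<in> H"
    and S: "S \<in> datasets Z n" and \<theta>: "\<theta> \<in> hyperparams n T"
  shows "m \<le> T \<Longrightarrow> sgd_iter \<alpha> g h0 S \<theta> m \<in> H"
proof (induction m)
  case (Suc m)
  thus ?case using steps dataset_sample_mem[OF S \<theta>, of m] by simp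
qed (simp add: h0)

lemma sum_if_eq_card:
  fixes m :: nat and c :: real
  shows "(\<Sum>t<m. if P t then c else 0) = c * real (card {t. t < m \<and> P t})"
proof -
  have "(\<Sum>t\<in>{t \<in> {..<m}. P t}. c) = (\<Sum>t<m. if P t then c else 0)"
    by (rule sum.inter_filter) simp
  moreover have "{t \<in> {..<m}. P t} = {t. t < m \<and> P t}" by auto
  ultimately show ?thesis by (simp add: mult.commute)
qed

lemma finite_hyperparams: "finite (hyperparams n T)"
proof -
  have "hyperparams n T = {\<theta>. set \<theta> \<subseteq> {1..n} \<and> length \<theta> = T}" unfolding hyperparams_def by auto
  thus ?thesis by (simp add: finite_lists_length_eq)
qed

lemma replicate_mem_hyperparams: "n \<ge> 1 \<Longrightarrow> replicate T 1 \<in> hyperparams n T"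
  unfolding hyperparams_def by auto

lemma sum_count_list_hyperparams_symmetric:
  assumes i: "i \<in> {1..n}" and j: "j \<in> {1..n}"
  shows "(\<Sum>\<theta>\<in>hyperparams n T. count_list \<theta> i) = (\<Sum>\<theta>\<in>hyperparams n T. count_list \<theta> j)"
proof -
  let ?\<tau> = "map (Transposition.transpose i j)"
  have mem: "?\<tau> \<theta> \<in> hyperparams n T" if "\<theta> \<in> hyperparams n T" for \<theta>
    using that i j unfolding hyperparams_def by (auto simp: Transposition.transpose_def)
  have "bij_betw ?\<tau> (hyperparams n T) (hyperparams n T)"
    by (rule bij_betwI[where g = ?\<tau>]) (auto simp: mem comp_def)
  hence "(\<Sum>\<theta>\<in>hyperparams n T. count_list \<theta> j) = (\<Sum>\<theta>\<in>hyperparams n T. count_list (?\<tau> \<theta>) j)"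
    by (rule sum.reindex_bij_betw[symmetric])
  also have "\<dots> = (\<Sum>\<theta>\<in>hyperparams n T. count_list \<theta> i)"
    using count_list_map_conv[OF Transposition.inj_transpose[of i j], of _ i] by simp
  finally show ?thesis by simp
qed

lemma sum_count_list_hyperparams:
  assumes j: "j \<in> {1..n}"
  shows "real n * (\<Sum>\<theta>\<in>hyperparams n T. real (count_list \<theta> j)) = real T * real (card (hyperparams n T))"
proof -
  have "n * (\<Sum>\<theta>\<in>hyperparams n T. count_list \<theta> j) = (\<Sum>i\<in>{1..n}. \<Sum>\<theta>\<in>hyperparams n T. count_list \<theta> i)"
    using sum_count_list_hyperparams_symmetric[OF _ j] by simp
  also have "\<dots> = (\<Sum>\<theta>\<in>hyperparams n T. \<Sum>i\<in>{1..n}. count_list \<theta> i)" by (rule sum.swap)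
  also have "\<dots> = (\<Sum>\<theta>\<in>hyperparams n T. T)"
    by (rule sum.cong) (auto simp: hyperparams_def sum_count_set)
  finally have "n * (\<Sum>\<theta>\<in>hyperparams n T. count_list \<theta> j) = T * card (hyperparams n T)" by simp
  thus ?thesis by (metis of_nat_mult of_nat_sum)
qed

lemma abs_expectation_hyperparams_le:
  fixes f :: "nat list \<Rightarrow> real"
  assumes j: "j \<in> {1..n}" and f: "\<And>\<theta>. \<theta> \<in> hyperparams n T \<Longrightarrow> \<bar>f \<theta>\<bar> \<le> c * real (count_list \<theta> j)"
  shows "\<bar>measure_pmf.expectation (pmf_of_set (hyperparams n T)) f\<bar> \<le> c * real T / real n"
proof -
  have HP: "finite (hyperparams n T)" "hyperparams n T \<noteq> {}" "card (hyperparams n T) > 0"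
    using finite_hyperparams replicate_mem_hyperparams[of n T] j by (auto simp: card_gt_0_iff)
  have "\<bar>measure_pmf.expectation (pmf_of_set (hyperparams n T)) f\<bar>
      = \<bar>\<Sum>\<theta>\<in>hyperparams n T. f \<theta>\<bar> / real (card (hyperparams n T))"
    by (simp add: integral_pmf_of_set[OF HP(2,1)])
  also have "\<dots> \<le> (\<Sum>\<theta>\<in>hyperparams n T. c * real (count_list \<theta> j)) / real (card (hyperparams n T))"
    using order_trans[OF sum_abs sum_mono[OF f]] by (intro divide_right_mono) auto
  also have "\<dots> = c * real T / real n"
    using sum_count_list_hyperparams[OF j, of T] j HP(3)
    by (simp add: sum_distrib_left[symmetric] field_simps)
  finally show ?thesis .
qed

lemma card_sample_disagreements_le_count_list:
  assumes \<theta>: "\<theta> \<in> hyperparams n T" and S: "length S = n" and k: "\<forall>i<n. S ! i \<noteq> S' ! i \<longrightarrow> i = k"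
  shows "card {t. t < T \<and> S ! (\<theta> ! t - 1) \<noteq> S' ! (\<theta> ! t - 1)} \<le> count_list \<theta> (Suc k)"
proof -
  have "{t. t < T \<and> S ! (\<theta> ! t - 1) \<noteq> S' ! (\<theta> ! t - 1)} \<subseteq> {t. t < length \<theta> \<and> Suc k = \<theta> ! t}"
  proof safe
    fix t assume t: "t < T" and ne: "S ! (\<theta> ! t - 1) \<noteq> S' ! (\<theta> ! t - 1)"
    have "\<theta> ! t \<in> set \<theta>" using \<theta> t unfolding hyperparams_def by simp
    hence "\<theta> ! t \<in> {1..n}" using \<theta> unfolding hyperparams_def by blast
    moreover have "\<theta> ! t - 1 < n" using \<open>\<theta> ! t \<in> {1..n}\<close> by auto
    hence "\<theta> ! t - 1 = k" using k ne by blast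
    ultimately show "Suc k = \<theta> ! t" by auto
    show "t < length \<theta>" using \<theta> t unfolding hyperparams_def by simp
  qed
  hence "card {t. t < T \<and> S ! (\<theta> ! t - 1) \<noteq> S' ! (\<theta> ! t - 1)} \<le> card {t. t < length \<theta> \<and> Suc k = \<theta> ! t}"
    by (rule card_mono[rotated]) simp
  thus ?thesis by (simp add: count_list_eq_length_filter length_filter_conv_card)
qed

section \<open>Uniform stability of SGD\<close>

locale sgd_run = strongly_convex_smooth H Z F g \<sigma> \<nu> L
  for H :: "'a::euclidean_space set" and Z :: "'z set" and F g \<sigma> \<nu> L +
  fixes h0 :: 'a and n T :: nat
  assumes h0_mem: "h0 \<in> H"
    and step_mem: "\<forall>h\<in>H. \<forall>z\<in>Z. \<forall>t\<in>{1..T}. h - (1 / (\<sigma> * real t + \<nu>)) *\<^sub>R g h z \<in> H"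
begin

abbreviation step_size :: "nat \<Rightarrow> real" where
  "step_size \<equiv> \<lambda>t. 1 / (\<sigma> * real t + \<nu>)"

lemma sgd_iter_distance:
  assumes S: "S \<in> datasets Z n" and S': "S' \<in> datasets Z n"
    and \<theta>: "\<theta> \<in> hyperparams n T" and \<theta>': "\<theta>' \<in> hyperparams n T"
  shows "m \<le> T \<Longrightarrow> (\<sigma> * real m + \<nu>) * norm (sgd_iter step_size g h0 S \<theta> m - sgd_iter step_size g h0 S' \<theta>' m)
           \<le> (\<Sum>t<m. if S ! (\<theta> ! t - 1) \<noteq> S' ! (\<theta>' ! t - 1) then 2 * L else 0)"
proof (induction m)
  case (Suc m)
  define h where "h = sgd_iter step_size g h0 S \<theta> m"
  define h' where "h' = sgd_iter step_size g h0 S' \<theta>' m"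
  define z where "z = S ! (\<theta> ! m - 1)"
  define z' where "z' = S' ! (\<theta>' ! m - 1)"
  define a where "a = step_size (Suc m)"
  define c where "c = \<sigma> * real (Suc m) + \<nu>"
  have h: "h \<in> H" and h': "h' \<in> H"
    using sgd_iter_mem[OF h0_mem step_mem] S S' \<theta> \<theta>' Suc.prems by (simp_all add: h_def h'_def)
  have z: "z \<in> Z" and z': "z' \<in> Z"
    using dataset_sample_mem[OF S \<theta>] dataset_sample_mem[OF S' \<theta>'] Suc.prems by (simp_all add: z_def z'_def)
  have c: "c > 0" using sigma_pos nu_pos by (simp add: c_def add_pos_pos)
  have a: "0 < a" "a \<le> 1 / (\<sigma> + \<nu>)"
    using c sigma_pos nu_pos by (simp_all add: a_def c_def frac_le)
  have ca: "c * a = 1" "c * (1 - a * \<sigma>) = \<sigma> * real m + \<nu>"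
    using c by (simp_all add: a_def c_def field_simps)
  have "norm ((h - a *\<^sub>R g h z) - (h' - a *\<^sub>R g h' z'))
      \<le> (1 - a * \<sigma>) * norm (h - h') + a * (if z \<noteq> z' then 2 * L else 0)"
    by (rule gradient_steps_distance[OF z z' h h' a])
  hence "c * norm ((h - a *\<^sub>R g h z) - (h' - a *\<^sub>R g h' z'))
      \<le> c * ((1 - a * \<sigma>) * norm (h - h') + a * (if z \<noteq> z' then 2 * L else 0))"
    using c by (intro mult_left_mono) simp_all
  also have "\<dots> = (c * (1 - a * \<sigma>)) * norm (h - h') + (c * a) * (if z \<noteq> z' then 2 * L else 0)"
    by (simp only: distrib_left mult.assoc)
  also have "\<dots> = (\<sigma> * real m + \<nu>) * norm (h - h') + (if z \<noteq> z' then 2 * L else 0)"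
    by (simp only: ca mult_1_left)
  finally have "c * norm ((h - a *\<^sub>R g h z) - (h' - a *\<^sub>R g h' z'))
      \<le> (\<sigma> * real m + \<nu>) * norm (h - h') + (if z \<noteq> z' then 2 * L else 0)" .
  thus ?case using Suc by (simp add: h_def h'_def z_def z'_def a_def c_def)
qed simp

lemma sgd_mem: "S \<in> datasets Z n \<Longrightarrow> \<theta> \<in> hyperparams n T \<Longrightarrow> sgd step_size g h0 S \<theta> \<in> H"
  using sgd_iter_mem[OF h0_mem step_mem] unfolding sgd_def hyperparams_def by auto

lemma sgd_loss_difference_le:
  assumes loss_lip: "lipschitz_in_h H Z l L"
    and S: "S \<in> datasets Z n" and S': "S' \<in> datasets Z n"
    and \<theta>: "\<theta> \<in> hyperparams n T" and \<theta>': "\<theta>' \<in> hyperparams n T" and z: "z \<in> Z"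
  shows "\<bar>l (sgd step_size g h0 S \<theta>) z - l (sgd step_size g h0 S' \<theta>') z\<bar>
    \<le> 2 * L\<^sup>2 / (\<sigma> * real T + \<nu>) * real (card {t. t < T \<and> S ! (\<theta> ! t - 1) \<noteq> S' ! (\<theta>' ! t - 1)})"
proof -
  let ?d = "norm (sgd step_size g h0 S \<theta> - sgd step_size g h0 S' \<theta>')"
  let ?C = "real (card {t. t < T \<and> S ! (\<theta> ! t - 1) \<noteq> S' ! (\<theta>' ! t - 1)})"
  have pos: "\<sigma> * real T + \<nu> > 0" using sigma_pos nu_pos by (simp add: add_nonneg_pos)
  have "(\<sigma> * real T + \<nu>) * ?d \<le> 2 * L * ?C"
    using sgd_iter_distance[OF S S' \<theta> \<theta>' order_refl] \<theta> \<theta>'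
    unfolding sgd_def sum_if_eq_card hyperparams_def by simp
  hence "?d \<le> 2 * L * ?C / (\<sigma> * real T + \<nu>)" using pos by (simp add: pos_le_divide_eq mult.commute)
  have "\<bar>l (sgd step_size g h0 S \<theta>) z - l (sgd step_size g h0 S' \<theta>') z\<bar> \<le> L * ?d"
    using loss_lip sgd_mem[OF S \<theta>] sgd_mem[OF S' \<theta>'] z unfolding lipschitz_in_h_def by blast
  also have "\<dots> \<le> L * (2 * L * ?C / (\<sigma> * real T + \<nu>))"
    using \<open>?d \<le> _\<close> L_nonneg by (rule mult_left_mono)
  also have "\<dots> = 2 * L\<^sup>2 / (\<sigma> * real T + \<nu>) * ?C" by (simp add: power2_eq_square)
  finally show ?thesis .
qed

lemma hyperparameter_stable:
  assumes T: "T \<ge> 1" and loss_lip: "lipschitz_in_h H Z l L"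
  shows "uniformly_hyper_stable Z n (hyperparams n T) (sgd step_size g h0) l (2 * L\<^sup>2 / (\<sigma> * real T))"
  unfolding uniformly_hyper_stable_def
proof (intro ballI impI)
  fix S z \<theta> \<theta>' assume S: "S \<in> datasets Z n" and z: "z \<in> Z"
    and \<theta>: "\<theta> \<in> hyperparams n T" and \<theta>': "\<theta>' \<in> hyperparams n T" and ham: "hamming \<theta> \<theta>' = 1"
  have "{t. t < T \<and> S ! (\<theta> ! t - 1) \<noteq> S ! (\<theta>' ! t - 1)} \<subseteq> {i. i < length \<theta> \<and> \<theta> ! i \<noteq> \<theta>' ! i}"
    using \<theta> unfolding hyperparams_def by auto
  hence "card {t. t < T \<and> S ! (\<theta> ! t - 1) \<noteq> S ! (\<theta>' ! t - 1)} \<le> 1"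
    using card_mono[of "{i. i < length \<theta> \<and> \<theta> ! i \<noteq> \<theta>' ! i}"] ham unfolding hamming_def by simp
  hence "2 * L\<^sup>2 / (\<sigma> * real T + \<nu>) * real (card {t. t < T \<and> S ! (\<theta> ! t - 1) \<noteq> S ! (\<theta>' ! t - 1)})
      \<le> 2 * L\<^sup>2 / (\<sigma> * real T + \<nu>)"
    using sigma_pos nu_pos by (intro mult_left_le) simp_all
  hence "\<bar>l (sgd step_size g h0 S \<theta>) z - l (sgd step_size g h0 S \<theta>') z\<bar> \<le> 2 * L\<^sup>2 / (\<sigma> * real T + \<nu>)"
    using sgd_loss_difference_le[OF loss_lip S S \<theta> \<theta>' z] by linarith
  also have "\<dots> \<le> 2 * L\<^sup>2 / (\<sigma> * real T)"
    using T sigma_pos nu_pos by (intro divide_left_mono) (auto intro!: mult_pos_pos add_pos_pos)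
  finally show "\<bar>l (sgd step_size g h0 S \<theta>) z - l (sgd step_size g h0 S \<theta>') z\<bar> \<le> 2 * L\<^sup>2 / (\<sigma> * real T)" .
qed

lemma data_stable:
  assumes loss_lip: "lipschitz_in_h H Z l L"
  shows "uniformly_data_stable Z n (sgd step_size g h0) l (pmf_of_set (hyperparams n T)) (2 * L\<^sup>2 / (\<sigma> * real n))"
  unfolding uniformly_data_stable_def
proof (intro ballI impI)
  fix S S' z assume S: "S \<in> datasets Z n" and S': "S' \<in> datasets Z n" and ham: "hamming S S' = 1"
    and z: "z \<in> Z"
  define c where "c = 2 * L\<^sup>2 / (\<sigma> * real T + \<nu>)"
  let ?f = "\<lambda>\<theta>. l (sgd step_size g h0 S \<theta>) z - l (sgd step_size g h0 S' \<theta>) z"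
  have length_S: "length S = n" using S unfolding datasets_def by simp
  obtain k where "{i. i < length S \<and> S ! i \<noteq> S' ! i} = {k}"
    using ham unfolding hamming_def by (rule card_1_singletonE)
  hence k_lt: "k < n" and only_k: "\<forall>i<n. S ! i \<noteq> S' ! i \<longrightarrow> i = k" using length_S by auto
  from k_lt have k: "Suc k \<in> {1..n}" by simp
  have c: "c \<ge> 0" using sigma_pos nu_pos by (simp add: c_def add_nonneg_pos)
  have "\<bar>measure_pmf.expectation (pmf_of_set (hyperparams n T)) ?f\<bar> \<le> c * real T / real n"
  proof (rule abs_expectation_hyperparams_le[OF k])
    fix \<theta> assume \<theta>: "\<theta> \<in> hyperparams n T"
    show "\<bar>?f \<theta>\<bar> \<le> c * real (count_list \<theta> (Suc k))"
      using sgd_loss_difference_le[OF loss_lip S S' \<theta> \<theta> z]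
        mult_left_mono[OF of_nat_mono[OF card_sample_disagreements_le_count_list[OF \<theta> length_S only_k]] c]
      unfolding c_def by linarith
  qed
  also have "\<dots> \<le> 2 * L\<^sup>2 / (\<sigma> * real n)"
  proof -
    have "\<sigma> * real T + \<nu> > 0" using sigma_pos nu_pos by (simp add: add_nonneg_pos)
    hence "real T / (\<sigma> * real T + \<nu>) \<le> 1 / \<sigma>"
      using sigma_pos nu_pos by (simp add: divide_le_eq field_simps)
    hence "2 * L\<^sup>2 * (real T / (\<sigma> * real T + \<nu>)) \<le> 2 * L\<^sup>2 * (1 / \<sigma>)"
      by (rule mult_left_mono) simp
    hence "c * real T \<le> 2 * L\<^sup>2 / \<sigma>" by (simp add: c_def)
    hence "c * real T / real n \<le> 2 * L\<^sup>2 / \<sigma> / real n" by (rule divide_right_mono) simp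
    thus ?thesis by simp
  qed
  finally show "\<bar>measure_pmf.expectation (pmf_of_set (hyperparams n T)) ?f\<bar> \<le> 2 * L\<^sup>2 / (\<sigma> * real n)" .
qed

end

lemma strongly_convex_le_smooth:
  assumes sc: "strongly_convex_in_h H Z F g \<sigma>" and sm: "smooth_in_h H Z g \<nu>"
    and x: "x \<in> H" and y: "y \<in> H" and xy: "x \<noteq> y" and z: "z \<in> Z"
  shows "\<sigma> \<le> \<nu>"
proof -
  have "\<sigma> / 2 * (norm (y - x))\<^sup>2 + inner (g x z) (y - x) \<le> F y z - F x z"
    and "\<sigma> / 2 * (norm (x - y))\<^sup>2 + inner (g y z) (x - y) \<le> F x z - F y z"
    using sc x y z unfolding strongly_convex_in_h_def by blast+
  moreover have "inner (g y z) (x - y) = - inner (g y z) (y - x)" "norm (x - y) = norm (y - x)"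
    by (simp_all add: inner_diff_right norm_minus_commute)
  ultimately have "\<sigma> * (norm (y - x))\<^sup>2 \<le> inner (g y z - g x z) (y - x)"
    by (simp add: inner_diff_left)
  also have "\<dots> \<le> norm (g y z - g x z) * norm (y - x)" by (rule norm_cauchy_schwarz)
  also have "\<dots> \<le> \<nu> * (norm (y - x))\<^sup>2"
    using sm x y z unfolding smooth_in_h_def power2_eq_square
    by (simp add: mult.assoc[symmetric] mult_right_mono)
  finally show ?thesis using xy by simp
qed

lemma lipschitz_in_h_nonneg:
  assumes "lipschitz_in_h H Z f L" "x \<in> H" "y \<in> H" "x \<noteq> y" "z \<in> Z"
  shows "0 \<le> L"
proof -
  have "0 \<le> L * norm (x - y)"
    using assms unfolding lipschitz_in_h_def by (meson abs_ge_zero order_trans)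
  thus ?thesis using assms(4) by (simp add: zero_le_mult_iff)
qed

lemma uniformly_stable_of_constant:
  assumes const: "\<forall>S\<in>datasets Z n. \<forall>\<theta>\<in>\<Theta>. A S \<theta> = c"
    and \<Theta>: "finite \<Theta>" "\<Theta> \<noteq> {}" and "0 \<le> \<beta>" "0 \<le> \<rho>"
  shows "uniformly_data_stable Z n A l (pmf_of_set \<Theta>) \<beta> \<and> uniformly_hyper_stable Z n \<Theta> A l \<rho>"
  unfolding uniformly_data_stable_def uniformly_hyper_stable_def
proof (intro conjI ballI impI)
  fix S S' z assume "S \<in> datasets Z n" "S' \<in> datasets Z n"
  hence "(\<Sum>\<theta>\<in>\<Theta>. l (A S \<theta>) z - l (A S' \<theta>) z) = 0" using const by simp
  thus "\<bar>measure_pmf.expectation (pmf_of_set \<Theta>) (\<lambda>\<theta>. l (A S \<theta>) z - l (A S' \<theta>) z)\<bar> \<le> \<beta>"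
    using \<open>0 \<le> \<beta>\<close> by (simp add: integral_pmf_of_set[OF \<Theta>(2,1)])
qed (use const \<open>0 \<le> \<rho>\<close> in simp)

theorem proposition4:
  fixes X :: "'x::topological_space set" and Y :: "'y set"
    and Z :: "('x \<times> 'y) set"
    and H :: "'a::euclidean_space set"
    and l F :: "'a \<Rightarrow> 'x \<times> 'y \<Rightarrow> real"
    and gradF :: "'a \<Rightarrow> 'x \<times> 'y \<Rightarrow> 'a"
    and L M \<sigma> \<nu> :: real and n T :: nat and h0 :: 'a
  assumes Z_def: "Z = X \<times> Y" and X_compact: "compact X"
    and n_pos: "n \<ge> 1" and T_pos: "T \<ge> 1"
    and sigma_pos: "\<sigma> > 0"
    and H_convex: "convex H"
    and h0_in: "h0 \<in> H"
    and loss_range: "\<forall>h\<in>H. \<forall>z\<in>Z. 0 \<le> l h z \<and> l h z \<le> M"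
    and loss_lip: "lipschitz_in_h H Z l L"
    and grad: "is_gradient H Z F gradF"
    and F_sc: "strongly_convex_in_h H Z F gradF \<sigma>"
    and F_lip: "lipschitz_in_h H Z F L"
    and F_smooth: "smooth_in_h H Z gradF \<nu>"
    and steps_in_H: "\<forall>h\<in>H. \<forall>z\<in>Z. \<forall>t\<in>{1..T}.
                       h - (1 / (\<sigma> * real t + \<nu>)) *\<^sub>R gradF h z \<in> H"
  shows "uniformly_data_stable Z n
           (sgd (\<lambda>t. 1 / (\<sigma> * real t + \<nu>)) gradF h0) l
           (pmf_of_set (hyperparams n T)) (2 * L\<^sup>2 / (\<sigma> * real n))
       \<and> uniformly_hyper_stable Z n (hyperparams n T)
           (sgd (\<lambda>t. 1 / (\<sigma> * real t + \<nu>)) gradF h0) l (2 * L\<^sup>2 / (\<sigma> * real T))"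
proof (cases "\<exists>z\<in>Z. \<exists>h\<in>H. h \<noteq> h0")
  case True
  then obtain z h where z: "z \<in> Z" and h: "h \<in> H" "h \<noteq> h0" by blast
  interpret sgd_run H Z F gradF \<sigma> \<nu> L h0 n T
  proof
    show "\<sigma> \<le> \<nu>" using strongly_convex_le_smooth[OF F_sc F_smooth h0_in h(1)] h z by auto
    show "L \<ge> 0" using lipschitz_in_h_nonneg[OF F_lip h0_in h(1)] h z by auto
    show "\<forall>h\<in>H. \<forall>z\<in>Z. h - (1 / (\<sigma> + \<nu>)) *\<^sub>R gradF h z \<in> H"
      using steps_in_H T_pos by (metis atLeastAtMost_iff le_refl mult.right_neutral of_nat_1)
  qed (use H_convex sigma_pos grad F_sc F_lip F_smooth h0_in steps_in_H in auto)
  show ?thesis using data_stable hyperparameter_stable T_pos loss_lip by blast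
next
  case False
  have "sgd (\<lambda>t. 1 / (\<sigma> * real t + \<nu>)) gradF h0 S \<theta> = h0"
    if S: "S \<in> datasets Z n" and \<theta>: "\<theta> \<in> hyperparams n T" for S \<theta>
  proof -
    have "S ! 0 \<in> Z" using S n_pos unfolding datasets_def by (auto intro: subsetD[OF _ nth_mem])
    hence "H \<subseteq> {h0}" using False by blast
    moreover have "sgd (\<lambda>t. 1 / (\<sigma> * real t + \<nu>)) gradF h0 S \<theta> \<in> H"
      using sgd_iter_mem[OF h0_in steps_in_H S \<theta>] \<theta> unfolding sgd_def hyperparams_def by simp
    ultimately show ?thesis by blast
  qed
  thus ?thesis
    using finite_hyperparams replicate_mem_hyperparams[OF n_pos, of T] sigma_pos
    by (intro uniformly_stable_of_constant) auto
qed

end
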